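(* Let $M,N$ be positive integers and let $T=c1+U\in\mathcal A_{M,N}$, where $c\in\mathbb C$ and $U\in\mathcal A_{M,N}$ has zero constant coefficient. For $B_1,\ldots,B_r\in\mathcal A_{M,N}$, the orbits of $B_1,\ldots,B_r$ under $T$ span $\mathcal A_{M,N}$, i.e. $\operatorname{span}_{\mathbb C}\{T^nB_j:n\geq0,\ 1\leq j\leq r\}=\mathcal A_{M,N}$, if and only if the residue classes of $B_1,\ldots,B_r$ span the complex vector space $\mathcal A_{M,N}/U\mathcal A_{M,N}$. Hence the minimum number $r$ of elements $B_1,\ldots,B_r$ (probes) whose orbits under $T$ span $\mathcal A_{M,N}$ is $$\mu(U)=\dim_{\mathbb C}(\mathcal A_{M,N}/U\mathcal A_{M,N}),$$ and $$\mu(U)\geq\left\lceil\frac{MN}{\nu(U)}\right\rceil.$$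
   Context: For positive integers $M,N$, $\mathcal A_{M,N}=\mathbb C[x,y]/(x^M,y^N)$, a commutative algebra of complex dimension $MN$ with basis $x^iy^j$, $0\le i<M$, $0\le j<N$, and identity $1$; the constant coefficient of an element is its coefficient at $x^0y^0$. (Equivalently, $\mathcal A_{M,N}$ is the space $\mathbb C^{M\times N}$ of matrices with truncated convolution, the Jury product, as multiplication.) For $U\in\mathcal A_{M,N}$ with zero constant coefficient (which is necessarily nilpotent), $\nu(U)$ denotes the smallest positive integer $\nu$ with $U^\nu=0$; in particular $\nu(0)=1$. $U\mathcal A_{M,N}$ is the ideal $\{UA:A\in\mathcal A_{M,N}\}$. *)

theory Defs
  imports "Jordan_Normal_Form.VS_Connect" "HOL-Algebra.QuotRing"
begin

text \<open>Algebras over a commutative ring are \<^typ>\<open>('a, 'b) module\<close> records, as in the locale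
  \<^locale>\<open>algebra\<close>. The scalar multiplication of a quotient follows the pattern
  of \<^const>\<open>rcoset_mult\<close>.\<close>

definition quot_algebra :: "('a, 'b) module \<Rightarrow> 'b set \<Rightarrow> ('a, 'b set) module" where
  "quot_algebra A J = ring.extend (A Quot J)
     (module.fields (\<lambda>c X. \<Union>x\<in>X. J +>\<^bsub>A\<^esub> (c \<odot>\<^bsub>A\<^esub> x)))"

text \<open>The polynomial algebra in two variables: the inner variable is $x$, the outer one is $y$,
  so the coefficient of $x^i y^j$ in \<open>p\<close> is \<open>coeff (coeff p j) i\<close>.\<close>

definition poly_algebra_xy :: "(complex, complex poly poly) module" where
  "poly_algebra_xy = \<lparr> carrier = UNIV, mult = (*), one = 1, zero = 0, add = (+),
     smult = (\<lambda>c p. [:[:c:]:] * p) \<rparr>"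

definition truncation_ideal :: "nat \<Rightarrow> nat \<Rightarrow> complex poly poly set" where
  "truncation_ideal M N = Idl\<^bsub>poly_algebra_xy\<^esub> {[:[:0, 1:]:] ^ M, [:0, 1:] ^ N}"

definition trunc_algebra :: "nat \<Rightarrow> nat \<Rightarrow> (complex, complex poly poly set) module" where
  "trunc_algebra M N = quot_algebra poly_algebra_xy (truncation_ideal M N)"

text \<open>For \<open>M, N > 0\<close> all representatives of a residue class have the same constant coefficient
  (see \<open>const_coeff_coset\<close> below).\<close>

definition const_coeff :: "complex poly poly set \<Rightarrow> complex" where
  "const_coeff X = the_elem ((\<lambda>p. coeff (coeff p 0) 0) ` X)"

text \<open>For \<open>M, N > 0\<close> and \<open>U\<close> with zero constant coefficient the minimum exists
  (see \<open>const_coeff_zero_nilpotent\<close> below).\<close>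

definition nilpotency_index :: "nat \<Rightarrow> nat \<Rightarrow> complex poly poly set \<Rightarrow> nat" where
  "nilpotency_index M N U =
     (LEAST n. 0 < n \<and> U [^]\<^bsub>trunc_algebra M N\<^esub> n = \<zero>\<^bsub>trunc_algebra M N\<^esub>)"

definition cokernel_algebra ::
  "nat \<Rightarrow> nat \<Rightarrow> complex poly poly set \<Rightarrow> (complex, complex poly poly set set) module" where
  "cokernel_algebra M N U = quot_algebra (trunc_algebra M N) (PIdl\<^bsub>trunc_algebra M N\<^esub> U)"

text \<open>\<open>vectorspace.dim\<close> is the least cardinality of a finite generating set; it is meaningful here
  by \<open>algebra_cokernel_algebra\<close> and \<open>vectorspace_algebra\<close> below.\<close>

definition mu :: "nat \<Rightarrow> nat \<Rightarrow> complex poly poly set \<Rightarrow> nat" where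
  "mu M N U = vectorspace.dim class_ring (cokernel_algebra M N U)"

definition orbits_span ::
  "nat \<Rightarrow> nat \<Rightarrow> complex poly poly set \<Rightarrow> nat \<Rightarrow> (nat \<Rightarrow> complex poly poly set) \<Rightarrow> bool" where
  "orbits_span M N T r B \<longleftrightarrow>
     LinearCombinations.module.span class_ring (trunc_algebra M N)
       {(T [^]\<^bsub>trunc_algebra M N\<^esub> n) \<otimes>\<^bsub>trunc_algebra M N\<^esub> B j | (n::nat) j. j \<in> {1..r}}
     = carrier (trunc_algebra M N)"

definition classes_span ::
  "nat \<Rightarrow> nat \<Rightarrow> complex poly poly set \<Rightarrow> nat \<Rightarrow> (nat \<Rightarrow> complex poly poly set) \<Rightarrow> bool" where
  "classes_span M N U r B \<longleftrightarrow>
     LinearCombinations.module.span class_ring (cokernel_algebra M N U)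
       ((\<lambda>j. (PIdl\<^bsub>trunc_algebra M N\<^esub> U) +>\<^bsub>trunc_algebra M N\<^esub> B j) ` {1..r})
     = carrier (cokernel_algebra M N U)"


lemma quot_algebra_sel:
  "carrier (quot_algebra A J) = carrier (A Quot J)"
  "mult (quot_algebra A J) = mult (A Quot J)"
  "one (quot_algebra A J) = one (A Quot J)"
  "zero (quot_algebra A J) = zero (A Quot J)"
  "add (quot_algebra A J) = add (A Quot J)"
  by (simp_all add: quot_algebra_def ring.defs module.defs)

lemma cring_quot_algebra:
  assumes "cring (A Quot J)"
  shows "cring (quot_algebra A J)"
proof -
  interpret Q: cring "A Quot J" by fact
  show ?thesis
  proof (rule cringI)
    show "abelian_group (quot_algebra A J)"
      using Q.a_inv_closed Q.l_neg
      by (intro abelian_groupI)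
         (auto simp: quot_algebra_sel Q.add.m_ac)
    show "Group.comm_monoid (quot_algebra A J)"
      by (intro comm_monoidI) (auto simp: quot_algebra_sel Q.m_ac)
  qed (auto simp: quot_algebra_sel Q.l_distr)
qed

lemma quot_algebra_smult_coset:
  assumes "algebra R A" "ideal J A" "c \<in> carrier R" "x \<in> carrier A"
  shows "c \<odot>\<^bsub>quot_algebra A J\<^esub> (J +>\<^bsub>A\<^esub> x) = J +>\<^bsub>A\<^esub> (c \<odot>\<^bsub>A\<^esub> x)"
proof -
  interpret A: algebra R A by fact
  interpret J: ideal J A by fact
  have eq: "J +>\<^bsub>A\<^esub> (c \<odot>\<^bsub>A\<^esub> z) = J +>\<^bsub>A\<^esub> (c \<odot>\<^bsub>A\<^esub> x)" if z: "z \<in> J +>\<^bsub>A\<^esub> x" for z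
  proof -
    from z obtain j where j: "j \<in> J" "z = j \<oplus>\<^bsub>A\<^esub> x"
      by (auto simp: a_r_coset_def')
    have jA: "j \<in> carrier A" using j J.Icarr by auto
    have "c \<odot>\<^bsub>A\<^esub> j = (c \<odot>\<^bsub>A\<^esub> \<one>\<^bsub>A\<^esub>) \<otimes>\<^bsub>A\<^esub> j"
      using A.smult_assoc2[of c "\<one>\<^bsub>A\<^esub>" j] jA assms by simp
    hence "c \<odot>\<^bsub>A\<^esub> j \<in> J"
      using J.I_l_closed[OF j(1)] assms by simp
    moreover have "c \<odot>\<^bsub>A\<^esub> z = c \<odot>\<^bsub>A\<^esub> j \<oplus>\<^bsub>A\<^esub> c \<odot>\<^bsub>A\<^esub> x"
      using j jA assms A.smult_r_distr by simp
    ultimately have "c \<odot>\<^bsub>A\<^esub> z \<in> J +>\<^bsub>A\<^esub> (c \<odot>\<^bsub>A\<^esub> x)"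
      by (auto simp: a_r_coset_def')
    thus ?thesis
      using J.a_repr_independence'[OF _ A.smult_closed[OF assms(3,4)]] by simp
  qed
  have "x \<in> J +>\<^bsub>A\<^esub> x"
    using assms J.a_rcos_self by blast
  hence "(\<Union>z\<in>J +>\<^bsub>A\<^esub> x. J +>\<^bsub>A\<^esub> (c \<odot>\<^bsub>A\<^esub> z)) = J +>\<^bsub>A\<^esub> (c \<odot>\<^bsub>A\<^esub> x)"
    using eq by blast
  thus ?thesis
    by (simp add: quot_algebra_def ring.defs module.defs)
qed

lemma algebra_quot_algebra:
  assumes "algebra R A" "ideal J A"
  shows "algebra R (quot_algebra A J)"
proof -
  interpret A: algebra R A by fact
  interpret J: ideal J A by fact
  have "cring A" using assms(1) by (rule algebra.axioms)
  hence Qc: "cring (A Quot J)" by (rule J.quotient_is_cring)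
  have car: "\<exists>x\<in>carrier A. X = J +>\<^bsub>A\<^esub> x" if "X \<in> carrier (A Quot J)" for X
    using that by (auto simp: FactRing_def A_RCOSETS_def')
  have carI: "J +>\<^bsub>A\<^esub> x \<in> carrier (A Quot J)" if "x \<in> carrier A" for x
    using that by (auto simp: FactRing_def A_RCOSETS_def')
  have add: "(J +>\<^bsub>A\<^esub> x) \<oplus>\<^bsub>A Quot J\<^esub> (J +>\<^bsub>A\<^esub> y) = J +>\<^bsub>A\<^esub> (x \<oplus>\<^bsub>A\<^esub> y)"
    if "x \<in> carrier A" "y \<in> carrier A" for x y
    using that J.a_rcos_sum by (simp add: FactRing_def)
  have mul: "(J +>\<^bsub>A\<^esub> x) \<otimes>\<^bsub>A Quot J\<^esub> (J +>\<^bsub>A\<^esub> y) = J +>\<^bsub>A\<^esub> (x \<otimes>\<^bsub>A\<^esub> y)"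
    if "x \<in> carrier A" "y \<in> carrier A" for x y
    using that J.rcoset_mult_add by (simp add: FactRing_def)
  note sm = quot_algebra_smult_coset[OF assms]
  show ?thesis
    apply (rule algebraI)
    subgoal by (rule A.R.is_cring)
    subgoal by (rule cring_quot_algebra[OF Qc])
    by (auto simp: quot_algebra_sel sm add mul carI A.smult_l_distr A.smult_r_distr
          A.smult_assoc1 A.smult_assoc2 dest!: car)
qed

lemma algebra_poly_algebra_xy: "algebra class_ring poly_algebra_xy"
proof -
  have c: "cring (class_ring :: complex ring)"
    by (rule class_cring.cring_axioms)
  have p: "cring poly_algebra_xy"
  proof (rule cringI)
    show "abelian_group poly_algebra_xy"
      by (rule abelian_groupI)
         (auto simp: poly_algebra_xy_def algebra_simps intro: exI[of _ "- x" for x])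
    show "Group.comm_monoid poly_algebra_xy"
      by (rule comm_monoidI) (auto simp: poly_algebra_xy_def algebra_simps)
  qed (auto simp: poly_algebra_xy_def algebra_simps)
  have add: "[:[:a + b:]:] = [:[:a:]:] + [:[:b:]:]" and mul: "[:[:a * b:]:] = [:[:a:]:] * [:[:b:]:]"
    and one: "[:[:1:]:] = 1" for a b :: complex
    by (simp_all add: one_pCons)
  show ?thesis
    by (rule algebraI[OF c p])
       (simp_all only: poly_algebra_xy_def partial_object.simps monoid.simps ring.simps
          module.simps UNIV_I add mul one distrib_left distrib_right mult.assoc mult_1_left)
qed

lemma ideal_truncation_ideal: "ideal (truncation_ideal M N) poly_algebra_xy"
proof -
  interpret P: cring poly_algebra_xy
    using algebra_poly_algebra_xy by (rule algebra.axioms)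
  show ?thesis
    unfolding truncation_ideal_def
    by (rule P.genideal_ideal) (simp add: poly_algebra_xy_def)
qed

lemma algebra_trunc_algebra: "algebra class_ring (trunc_algebra M N)"
  unfolding trunc_algebra_def
  by (rule algebra_quot_algebra[OF algebra_poly_algebra_xy ideal_truncation_ideal])

lemma algebra_cokernel_algebra:
  assumes "U \<in> carrier (trunc_algebra M N)"
  shows "algebra class_ring (cokernel_algebra M N U)"
proof -
  interpret A: cring "trunc_algebra M N"
    using algebra_trunc_algebra by (rule algebra.axioms)
  show ?thesis
    unfolding cokernel_algebra_def
    by (rule algebra_quot_algebra[OF algebra_trunc_algebra A.cgenideal_ideal[OF assms]])
qed

lemma vectorspace_algebra:
  assumes "algebra (class_ring :: complex ring) A"
  shows "vectorspace class_ring A"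
proof -
  interpret A: algebra "class_ring :: complex ring" A by fact
  show ?thesis
    by (intro vectorspace.intro A.module_axioms class_field.field_axioms)
qed

lemma truncation_ideal_eq:
  "truncation_ideal M N = {[:[:0, 1:]:] ^ M * a + [:0, 1:] ^ N * b | a b. True}" (is "_ = ?I")
proof
  interpret P: cring poly_algebra_xy
    using algebra_poly_algebra_xy by (rule algebra.axioms)
  have sel: "carrier poly_algebra_xy = UNIV" "add poly_algebra_xy = (+)"
    "mult poly_algebra_xy = (*)" "zero poly_algebra_xy = 0" "one poly_algebra_xy = 1"
    by (simp_all add: poly_algebra_xy_def)
  have neg: "\<ominus>\<^bsub>poly_algebra_xy\<^esub> a = - a" for a
    by (rule P.minus_equality) (auto simp: sel)
  have id: "ideal ?I poly_algebra_xy"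
  proof (rule idealI)
    show "ring poly_algebra_xy" by (rule P.ring_axioms)
    show "subgroup ?I (add_monoid poly_algebra_xy)"
    proof (rule P.add.subgroupI)
      show "?I \<noteq> {}" by blast
    next
      fix a assume "a \<in> ?I"
      then obtain p q where "a = [:[:0, 1:]:] ^ M * p + [:0, 1:] ^ N * q" by blast
      hence "- a = [:[:0, 1:]:] ^ M * (- p) + [:0, 1:] ^ N * (- q)" by simp
      thus "\<ominus>\<^bsub>poly_algebra_xy\<^esub> a \<in> ?I" unfolding neg by blast
    next
      fix a b assume "a \<in> ?I" "b \<in> ?I"
      then obtain p q p' q' where "a = [:[:0, 1:]:] ^ M * p + [:0, 1:] ^ N * q"
        "b = [:[:0, 1:]:] ^ M * p' + [:0, 1:] ^ N * q'" by blast
      hence "a + b = [:[:0, 1:]:] ^ M * (p + p') + [:0, 1:] ^ N * (q + q')"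
        by (simp add: algebra_simps)
      thus "a \<oplus>\<^bsub>poly_algebra_xy\<^esub> b \<in> ?I" unfolding sel by blast
    qed (simp add: sel)
  next
    fix a x assume "a \<in> ?I"
    then obtain p q where "a = [:[:0, 1:]:] ^ M * p + [:0, 1:] ^ N * q" by blast
    hence *: "x * a = [:[:0, 1:]:] ^ M * (x * p) + [:0, 1:] ^ N * (x * q)"
      by (simp only: algebra_simps)
    thus "x \<otimes>\<^bsub>poly_algebra_xy\<^esub> a \<in> ?I" unfolding sel by blast
    have "a * x = [:[:0, 1:]:] ^ M * (x * p) + [:0, 1:] ^ N * (x * q)"
      using * by (simp only: mult.commute[of a x])
    thus "a \<otimes>\<^bsub>poly_algebra_xy\<^esub> x \<in> ?I" unfolding sel by blast
  qed
  have "[:[:0, 1:]:] ^ M = [:[:0, 1:]:] ^ M * 1 + [:0, 1:] ^ N * (0 :: complex poly poly)"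
       "[:0, 1:] ^ N = [:[:0, 1:]:] ^ M * 0 + [:0, 1:] ^ N * (1 :: complex poly poly)"
    by simp_all
  hence "{[:[:0, 1:]:] ^ M, [:0, 1:] ^ N} \<subseteq> ?I" by blast
  thus "truncation_ideal M N \<subseteq> ?I"
    unfolding truncation_ideal_def by (rule P.genideal_minimal[OF id])
  interpret J: ideal "truncation_ideal M N" poly_algebra_xy
    by (rule ideal_truncation_ideal)
  have g: "{[:[:0, 1:]:] ^ M, [:0, 1:] ^ N} \<subseteq> truncation_ideal M N"
    unfolding truncation_ideal_def by (rule P.genideal_self) (simp add: sel)
  show "?I \<subseteq> truncation_ideal M N"
  proof
    fix z assume "z \<in> ?I"
    then obtain a b where z: "z = [:[:0, 1:]:] ^ M * a + [:0, 1:] ^ N * b" by blast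
    have "[:[:0, 1:]:] ^ M * a \<in> truncation_ideal M N" "[:0, 1:] ^ N * b \<in> truncation_ideal M N"
      using g J.I_r_closed[of _ a] J.I_r_closed[of _ b] unfolding sel by blast+
    thus "z \<in> truncation_ideal M N"
      using J.a_closed z unfolding sel by blast
  qed
qed

lemma const_coeff_coset:
  assumes "0 < M" "0 < N"
  shows "const_coeff (truncation_ideal M N +>\<^bsub>poly_algebra_xy\<^esub> p) = coeff (coeff p 0) 0"
proof -
  have 0: "coeff (coeff q 0) 0 = 0" if "q \<in> truncation_ideal M N" for q
    using that assms unfolding truncation_ideal_eq
    by (auto simp: coeff_mult_0 coeff_0_power zero_power)
  have ne: "0 \<in> truncation_ideal M N"
    unfolding truncation_ideal_eq by (auto intro: exI[of _ 0])
  have "(\<lambda>p. coeff (coeff p 0) 0) ` (truncation_ideal M N +>\<^bsub>poly_algebra_xy\<^esub> p)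
        = {coeff (coeff p 0) 0}"
    using 0 ne by (auto simp: a_r_coset_def' poly_algebra_xy_def image_iff intro!: bexI[of _ 0])
  thus ?thesis by (simp add: const_coeff_def)
qed

lemma const_coeff_zero_nilpotent:
  assumes "0 < M" "0 < N" "U \<in> carrier (trunc_algebra M N)" "const_coeff U = 0"
  shows "U [^]\<^bsub>trunc_algebra M N\<^esub> (M + N) = \<zero>\<^bsub>trunc_algebra M N\<^esub>"
proof -
  let ?I = "truncation_ideal M N"
  let ?X = "[:[:0, 1:]:] :: complex poly poly" and ?Y = "[:0, 1:] :: complex poly poly"
  interpret I: ideal ?I poly_algebra_xy
    by (rule ideal_truncation_ideal)
  obtain p where p: "U = ?I +>\<^bsub>poly_algebra_xy\<^esub> p"
    using assms(3)
    by (auto simp: trunc_algebra_def quot_algebra_sel FactRing_def A_RCOSETS_def')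
  have p0: "coeff (coeff p 0) 0 = 0"
    using assms const_coeff_coset p by metis
  obtain a b where ab: "p = pCons a b" by (cases p)
  obtain c d where cd: "a = pCons c d" by (cases a)
  have c0: "c = 0" using p0 ab cd by simp
  have pe: "p = ?X * [:d:] + ?Y * b"
    using ab cd c0 by simp
  have mem: "?X ^ i * ?Y ^ j * q \<in> ?I" if "i \<ge> M \<or> j \<ge> N" for i j q
  proof (cases "i \<ge> M")
    case True
    then obtain k where "i = M + k" using le_Suc_ex by blast
    hence "?X ^ i * ?Y ^ j * q = ?X ^ M * (?X ^ k * ?Y ^ j * q) + ?Y ^ N * 0"
      by (simp add: power_add mult_ac)
    thus ?thesis unfolding truncation_ideal_eq by blast
  next
    case False
    with that obtain k where "j = N + k" using le_Suc_ex by blast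
    hence "?X ^ i * ?Y ^ j * q = ?X ^ M * 0 + ?Y ^ N * (?Y ^ k * ?X ^ i * q)"
      by (simp add: power_add mult_ac)
    thus ?thesis unfolding truncation_ideal_eq by blast
  qed
  have sumI: "sum f S \<in> ?I" if "\<And>k. k \<in> S \<Longrightarrow> f k \<in> ?I" "finite S" for f and S :: "nat set"
    using that(2,1)
  proof (induction S rule: finite_induct)
    case empty
    have "\<zero>\<^bsub>poly_algebra_xy\<^esub> \<in> ?I" by (rule additive_subgroup.zero_closed[OF I.additive_subgroup_axioms])
    thus ?case by (simp add: poly_algebra_xy_def)
  next
    case (insert x F)
    thus ?case 
      using additive_subgroup.a_closed[OF I.additive_subgroup_axioms, of "f x" "sum f F"]
      by (simp add: poly_algebra_xy_def)
  qed
  have "p ^ (M + N) = (\<Sum>k\<le>M + N. of_nat ((M + N) choose k) * (?X * [:d:]) ^ k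
      * (?Y * b) ^ (M + N - k))"
    unfolding pe by (rule binomial_ring)
  also have "\<dots> = (\<Sum>k\<le>M + N. ?X ^ k * ?Y ^ (M + N - k)
      * (of_nat ((M + N) choose k) * [:d:] ^ k * b ^ (M + N - k)))"
    by (intro sum.cong refl) (simp only: power_mult_distrib mult_ac)
  also have "\<dots> \<in> ?I"
    by (intro sumI mem) auto
  finally have pI: "p ^ (M + N) \<in> ?I" .
  have pow: "U [^]\<^bsub>trunc_algebra M N\<^esub> n = ?I +>\<^bsub>poly_algebra_xy\<^esub> (p ^ n)" for n :: nat
  proof (induction n)
    case 0
    show ?case
      by (simp add: trunc_algebra_def quot_algebra_sel FactRing_def nat_pow_def
          poly_algebra_xy_def)
  next
    case (Suc n)
    have "(?I +>\<^bsub>poly_algebra_xy\<^esub> (p ^ n)) \<otimes>\<^bsub>trunc_algebra M N\<^esub> (?I +>\<^bsub>poly_algebra_xy\<^esub> p)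
        = ?I +>\<^bsub>poly_algebra_xy\<^esub> (p ^ n * p)"
      using I.rcoset_mult_add[of "p ^ n" p]
      by (simp add: trunc_algebra_def quot_algebra_sel FactRing_def poly_algebra_xy_def)
    thus ?case using Suc p by (simp add: nat_pow_def mult.commute)
  qed
  have "?I +>\<^bsub>poly_algebra_xy\<^esub> (p ^ (M + N)) = ?I"
    using pI I.a_coset_join2[of "p ^ (M + N)"] I.a_subgroup
    by (simp add: poly_algebra_xy_def I.a_rcos_const)
  thus ?thesis
    unfolding pow by (simp add: trunc_algebra_def quot_algebra_sel FactRing_def)
qed

end

theory Submission
  imports Defs
begin

text \<open>Write $A$ for the truncated algebra and $W$ for the span of the orbits of the $B_j$ under
  $T = c1 + U$.

  Modulo $UA$ the element $T$ acts as the scalar $c$, so the image of $W$ in $A/UA$ is the span of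
  the classes of the $B_j$; if $W = A$, the classes span $A/UA$. Conversely, $W$ is stable under $T$,
  hence under $U = T - c1$, and contains the $B_j$; if the classes span, then $A = W + UA$.
  Substituting this equation into itself gives $A = W + U^k A$ for every $k$, and $U$ is nilpotent, so
  $A = W$. This is Nakayama's lemma with an explicit nilpotent element
  (\<open>nilpotent_nakayama\<close>); the equivalence is \<open>span_orbits_eq_carrier_iff\<close>.

  The equivalence turns the minimal number of probes into the minimal size of a generating set of
  $A/UA$, which is how the dimension of a vector space is defined here: an arbitrary
  generating set lifts to $A$ (\<open>classes_span_mu\<close>), and every spanning family of classes has at least
  that many members (\<open>mu_le_if_classes_span\<close>).

  For the lower bound, apply the equivalence with $c = 0$: the orbits under $U$ of lifts
  $B_1, \dots, B_\mu$ of a generating set span $A$. Only the powers $U^k$ with $k < \nu$ are nonzero, so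
  $\nu\mu$ elements span $A$ (\<open>span_nilpotent_powers\<close>). Since the $MN$ monomials $x^i y^j$ are linearly
  independent in $A$ (\<open>residue_monomials_independent\<close>), $MN \le \nu\mu$.\<close>


section \<open>Submodules and spans under module homomorphisms\<close>

lemma image_eq_image_iff:
  assumes "W \<subseteq> C"
  shows "f ` W = f ` C \<longleftrightarrow> (\<forall>a\<in>C. \<exists>w\<in>W. f a = f w)"
  using image_mono[OF assms, of f] by (simp add: set_eq_subset image_subset_iff image_iff)

lemma (in mod_hom) submodule_image:
  assumes "submodule R W M"
  shows "submodule R (f ` W) N"
proof -
  interpret W: submodule R W M by fact
  have sub: "w \<in> carrier M" if "w \<in> W" for w using W.subset that by blast
  show ?thesis
  proof (unfold_locales)
    fix v w assume "v \<in> f ` W" "w \<in> f ` W"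
    then obtain a b where "a \<in> W" "b \<in> W" "v = f a" "w = f b" by blast
    thus "v \<oplus>\<^bsub>N\<^esub> w \<in> f ` W"
      using f_add sub by (metis W.m_closed image_eqI)
  next
    show "\<zero>\<^bsub>N\<^esub> \<in> f ` W" using f0_is_0 W.zero_closed by (metis image_eqI)
  next
    fix c v assume "c \<in> carrier R" "v \<in> f ` W"
    thus "c \<odot>\<^bsub>N\<^esub> v \<in> f ` W"
      using f_smult sub W.smult_closed by (metis (no_types, lifting) image_iff)
  qed (use sub in auto)
qed

lemma (in mod_hom) submodule_vimage:
  assumes "submodule R L N"
  shows "submodule R {x \<in> carrier M. f x \<in> L} M"
proof -
  interpret L: submodule R L N by fact
  show ?thesis by unfold_locales auto
qed

lemma (in mod_hom) image_span:
  assumes "S \<subseteq> carrier M"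
  shows "f ` M.span S = N.span (f ` S)"
proof
  have fS: "f ` S \<subseteq> carrier N" using assms by auto
  have "S \<subseteq> {x \<in> carrier M. f x \<in> N.span (f ` S)}"
    using assms N.in_own_span[OF fS] by auto
  thus "f ` M.span S \<subseteq> N.span (f ` S)"
    using M.span_is_subset[OF _ submodule_vimage[OF N.span_is_submodule[OF fS]]] by blast
  show "N.span (f ` S) \<subseteq> f ` M.span S"
    using M.in_own_span[OF assms]
    by (intro N.span_is_subset submodule_image M.span_is_submodule assms) auto
qed

section \<open>Subspaces stable under multiplication by an element\<close>

context algebra
begin

lemma mult_smult_right:
  assumes "c \<in> carrier R" "x \<in> carrier M" "y \<in> carrier M"
  shows "x \<otimes>\<^bsub>M\<^esub> (c \<odot>\<^bsub>M\<^esub> y) = c \<odot>\<^bsub>M\<^esub> (x \<otimes>\<^bsub>M\<^esub> y)"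
  using smult_assoc2[of c y x] assms by (simp add: m_comm)

lemma mod_hom_mult:
  assumes "u \<in> carrier M"
  shows "mod_hom R M M (\<lambda>x. u \<otimes>\<^bsub>M\<^esub> x)"
  using assms by unfold_locales (auto simp: LinearCombinations.module_hom_def r_distr mult_smult_right)

lemma mult_stable_pow:
  assumes "u \<in> carrier M" "W \<subseteq> carrier M" "\<And>w. w \<in> W \<Longrightarrow> u \<otimes>\<^bsub>M\<^esub> w \<in> W" "w \<in> W"
  shows "u [^]\<^bsub>M\<^esub> (k::nat) \<otimes>\<^bsub>M\<^esub> w \<in> W"
proof (induction k)
  case 0
  thus ?case using assms by auto
next
  case (Suc k)
  have "u [^]\<^bsub>M\<^esub> Suc k \<otimes>\<^bsub>M\<^esub> w = u \<otimes>\<^bsub>M\<^esub> (u [^]\<^bsub>M\<^esub> k \<otimes>\<^bsub>M\<^esub> w)"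
    using assms by (subst m_assoc[symmetric]) (auto simp: m_comm)
  thus ?case using Suc assms(3) by simp
qed

text \<open>The elements that \<open>u\<close> carries into \<open>span S\<close> form a submodule, so stability has to be checked
  on the generators only.\<close>

lemma span_mult_stable:
  assumes "u \<in> carrier M" "S \<subseteq> carrier M" "\<And>s. s \<in> S \<Longrightarrow> u \<otimes>\<^bsub>M\<^esub> s \<in> span S" "x \<in> span S"
  shows "u \<otimes>\<^bsub>M\<^esub> x \<in> span S"
proof -
  interpret u: mod_hom R M M "\<lambda>x. u \<otimes>\<^bsub>M\<^esub> x" using mod_hom_mult[OF assms(1)] .
  have "span S \<subseteq> {x \<in> carrier M. u \<otimes>\<^bsub>M\<^esub> x \<in> span S}"
    using assms by (intro span_is_subset u.submodule_vimage span_is_submodule) auto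
  thus ?thesis using assms(4) by blast
qed

text \<open>Substituting $M = W + uM$ into itself and absorbing $u^k W$ into $W$ gives
  $M = W + u^k M$ for every $k$; the second summand vanishes for $k = n$.\<close>

lemma nilpotent_nakayama:
  assumes u: "u \<in> carrier M" and nil: "u [^]\<^bsub>M\<^esub> (n::nat) = \<zero>\<^bsub>M\<^esub>"
    and W: "submodule R W M" and stable: "\<And>w. w \<in> W \<Longrightarrow> u \<otimes>\<^bsub>M\<^esub> w \<in> W"
    and sum: "\<And>a. a \<in> carrier M \<Longrightarrow> \<exists>w\<in>W. \<exists>b\<in>carrier M. a = w \<oplus>\<^bsub>M\<^esub> u \<otimes>\<^bsub>M\<^esub> b"
  shows "W = carrier M"
proof
  interpret W: submodule R W M by fact
  note sub = subsetD[OF W.subset]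
  show "W \<subseteq> carrier M" by (rule W.subset)
  have iter: "\<exists>w\<in>W. \<exists>b\<in>carrier M. a = w \<oplus>\<^bsub>M\<^esub> u [^]\<^bsub>M\<^esub> k \<otimes>\<^bsub>M\<^esub> b" if "a \<in> carrier M" for a and k :: nat
  proof (induction k)
    case 0
    show ?case using that W.zero_closed by (intro bexI[of _ "\<zero>\<^bsub>M\<^esub>"] bexI[of _ a]) auto
  next
    case (Suc k)
    then obtain w b where wb: "w \<in> W" "b \<in> carrier M" "a = w \<oplus>\<^bsub>M\<^esub> u [^]\<^bsub>M\<^esub> k \<otimes>\<^bsub>M\<^esub> b" by blast
    obtain v d where vd: "v \<in> W" "d \<in> carrier M" "b = v \<oplus>\<^bsub>M\<^esub> u \<otimes>\<^bsub>M\<^esub> d" using sum[OF wb(2)] by blast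
    have "a = (w \<oplus>\<^bsub>M\<^esub> u [^]\<^bsub>M\<^esub> k \<otimes>\<^bsub>M\<^esub> v) \<oplus>\<^bsub>M\<^esub> u [^]\<^bsub>M\<^esub> Suc k \<otimes>\<^bsub>M\<^esub> d"
      using wb vd u sub by (simp add: r_distr m_assoc M.a_assoc)
    moreover have "w \<oplus>\<^bsub>M\<^esub> u [^]\<^bsub>M\<^esub> k \<otimes>\<^bsub>M\<^esub> v \<in> W"
      using mult_stable_pow[OF u W.subset stable vd(1)] wb(1) by blast
    ultimately show ?case using vd(2) by blast
  qed
  show "carrier M \<subseteq> W"
  proof
    fix a assume "a \<in> carrier M"
    then obtain w b where "w \<in> W" "b \<in> carrier M" "a = w \<oplus>\<^bsub>M\<^esub> u [^]\<^bsub>M\<^esub> n \<otimes>\<^bsub>M\<^esub> b" using iter by blast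
    thus "a \<in> W" using sub by (simp add: nil)
  qed
qed

definition orbits :: "'c \<Rightarrow> 'c set \<Rightarrow> 'c set" where
  "orbits t X = {t [^]\<^bsub>M\<^esub> n \<otimes>\<^bsub>M\<^esub> x | (n::nat) x. x \<in> X}"

lemma orbits_closed: "t \<in> carrier M \<Longrightarrow> X \<subseteq> carrier M \<Longrightarrow> orbits t X \<subseteq> carrier M"
  by (auto simp: orbits_def)

lemma subset_orbits: "t \<in> carrier M \<Longrightarrow> X \<subseteq> carrier M \<Longrightarrow> X \<subseteq> orbits t X"
  by (force simp: orbits_def intro: exI[of _ "0::nat"])

text \<open>Together with \<open>subset_orbits\<close> and \<open>mult_orbits\<close>: the orbits form the least set that contains
  \<open>X\<close> and is stable under \<open>t\<close>.\<close>

lemma orbits_minimal: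
  assumes "t \<in> carrier M" "W \<subseteq> carrier M" "X \<subseteq> W" "\<And>w. w \<in> W \<Longrightarrow> t \<otimes>\<^bsub>M\<^esub> w \<in> W"
  shows "orbits t X \<subseteq> W"
  using mult_stable_pow[OF assms(1,2,4)] assms(3) by (auto simp: orbits_def)

lemma mult_orbits:
  assumes "t \<in> carrier M" "X \<subseteq> carrier M" "s \<in> orbits t X"
  shows "t \<otimes>\<^bsub>M\<^esub> s \<in> orbits t X"
proof -
  obtain n x where s: "x \<in> X" "s = t [^]\<^bsub>M\<^esub> (n::nat) \<otimes>\<^bsub>M\<^esub> x" using assms(3) by (auto simp: orbits_def)
  hence "t \<otimes>\<^bsub>M\<^esub> s = t [^]\<^bsub>M\<^esub> Suc n \<otimes>\<^bsub>M\<^esub> x"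
    using assms by (auto simp: m_assoc[symmetric] m_comm)
  thus ?thesis using s unfolding orbits_def by blast
qed

end

section \<open>Orbits and residue classes modulo a nilpotent element\<close>

text \<open>Algebra records with no fields beyond those of a module record, the ones for which
  \<^const>\<open>quot_algebra\<close> is defined.\<close>

locale plain_algebra = algebra R A
  for R :: "('r, 's) ring_scheme" and A :: "('r, 'a) module"
begin

lemma mod_hom_coset:
  assumes "ideal J A"
  shows "mod_hom R A (quot_algebra A J) (\<lambda>x. J +>\<^bsub>A\<^esub> x)"
proof -
  interpret J: ideal J A by fact
  interpret Q: algebra R "quot_algebra A J"
    using algebra_quot_algebra[OF algebra_axioms assms] .
  show ?thesis
  proof
    show "(\<lambda>x. J +>\<^bsub>A\<^esub> x) \<in> LinearCombinations.module_hom R A (quot_algebra A J)"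
      using quot_algebra_smult_coset[OF algebra_axioms assms] J.a_rcos_sum
      by (auto simp: LinearCombinations.module_hom_def quot_algebra_sel FactRing_def A_RCOSETS_def')
  qed
qed

lemma carrier_quot_algebra: "carrier (quot_algebra A J) = (\<lambda>x. J +>\<^bsub>A\<^esub> x) ` carrier A"
  by (auto simp: quot_algebra_sel FactRing_def A_RCOSETS_def')

text \<open>Surjectivity onto the quotient by the principal ideal of \<open>u\<close>, restated as $A = W + uA$, the
  form in which \<open>nilpotent_nakayama\<close> consumes it.\<close>

lemma image_coset_eq_carrier_iff:
  assumes u: "u \<in> carrier A" and W: "W \<subseteq> carrier A"
  defines "J \<equiv> PIdl\<^bsub>A\<^esub> u"
  shows "(\<lambda>x. J +>\<^bsub>A\<^esub> x) ` W = carrier (quot_algebra A J) \<longleftrightarrow>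
    (\<forall>a\<in>carrier A. \<exists>w\<in>W. \<exists>b\<in>carrier A. a = w \<oplus>\<^bsub>A\<^esub> u \<otimes>\<^bsub>A\<^esub> b)"
proof -
  interpret J: ideal J A unfolding J_def by (rule cgenideal_ideal[OF u])
  have eq: "J +>\<^bsub>A\<^esub> a = J +>\<^bsub>A\<^esub> w \<longleftrightarrow> (\<exists>b\<in>carrier A. a = w \<oplus>\<^bsub>A\<^esub> u \<otimes>\<^bsub>A\<^esub> b)"
    if "a \<in> carrier A" "w \<in> carrier A" for a w
  proof -
    have "J +>\<^bsub>A\<^esub> a = J +>\<^bsub>A\<^esub> w \<longleftrightarrow> a \<in> J +>\<^bsub>A\<^esub> w"
      using that J.a_repr_independence' J.a_rcos_self by blast
    also have "\<dots> \<longleftrightarrow> (\<exists>b\<in>carrier A. a = b \<otimes>\<^bsub>A\<^esub> u \<oplus>\<^bsub>A\<^esub> w)"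
      unfolding a_r_coset_def' J_def cgenideal_def by blast
    also have "\<dots> \<longleftrightarrow> (\<exists>b\<in>carrier A. a = w \<oplus>\<^bsub>A\<^esub> u \<otimes>\<^bsub>A\<^esub> b)"
      using that u by (intro bex_cong refl) (simp only: m_comm[OF u] M.a_comm[OF that(2) m_closed[OF _ u]])
    finally show ?thesis .
  qed
  have eq_bex: "(\<exists>w\<in>W. J +>\<^bsub>A\<^esub> a = J +>\<^bsub>A\<^esub> w) \<longleftrightarrow>
      (\<exists>w\<in>W. \<exists>b\<in>carrier A. a = w \<oplus>\<^bsub>A\<^esub> u \<otimes>\<^bsub>A\<^esub> b)" if "a \<in> carrier A" for a
    using eq[OF that subsetD[OF W]] by (rule bex_cong[OF refl])
  have "(\<lambda>x. J +>\<^bsub>A\<^esub> x) ` W = carrier (quot_algebra A J) \<longleftrightarrow>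
      (\<forall>a\<in>carrier A. \<exists>w\<in>W. J +>\<^bsub>A\<^esub> a = J +>\<^bsub>A\<^esub> w)"
    unfolding carrier_quot_algebra by (rule image_eq_image_iff[OF W])
  also have "\<dots> \<longleftrightarrow> (\<forall>a\<in>carrier A. \<exists>w\<in>W. \<exists>b\<in>carrier A. a = w \<oplus>\<^bsub>A\<^esub> u \<otimes>\<^bsub>A\<^esub> b)"
    by (rule ball_cong[OF refl eq_bex])
  finally show ?thesis .
qed

text \<open>The core of the argument. Since $t - c1 = u$ lies in $J$, multiplication by $t$ induces the scalar
  $c$ on $A/J$, so the orbits stay in the span of the classes of \<open>X\<close>. In the other direction
  a $t$-stable submodule is also $u$-stable, and \<open>nilpotent_nakayama\<close> applies.\<close>

lemma span_orbits_eq_carrier_iff: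
  assumes u: "u \<in> carrier A" and nil: "u [^]\<^bsub>A\<^esub> (n::nat) = \<zero>\<^bsub>A\<^esub>" and c: "c \<in> carrier R"
    and t: "t = c \<odot>\<^bsub>A\<^esub> \<one>\<^bsub>A\<^esub> \<oplus>\<^bsub>A\<^esub> u" and X: "X \<subseteq> carrier A"
  defines "J \<equiv> PIdl\<^bsub>A\<^esub> u"
  shows "span (orbits t X) = carrier A \<longleftrightarrow>
    LinearCombinations.module.span R (quot_algebra A J) ((\<lambda>x. J +>\<^bsub>A\<^esub> x) ` X)
      = carrier (quot_algebra A J)"
proof -
  have J: "ideal J A" unfolding J_def by (rule cgenideal_ideal[OF u])
  interpret J: ideal J A by (fact J)
  interpret q: mod_hom R A "quot_algebra A J" "\<lambda>x. J +>\<^bsub>A\<^esub> x" by (rule mod_hom_coset[OF J])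
  have tM: "t \<in> carrier A" using t u c by simp
  have tx: "t \<otimes>\<^bsub>A\<^esub> x = c \<odot>\<^bsub>A\<^esub> x \<oplus>\<^bsub>A\<^esub> u \<otimes>\<^bsub>A\<^esub> x" if "x \<in> carrier A" for x
    using that t u c by (simp add: l_distr smult_assoc2)
  have O: "orbits t X \<subseteq> carrier A" using orbits_closed[OF tM X] .
  have spanX: "span X \<subseteq> carrier A" using span_is_subset2[OF X] .
  show ?thesis
  proof
    assume full: "span (orbits t X) = carrier A"
    \<comment> \<open>The preimage of the span of the classes is a $t$-stable submodule that contains \<open>X\<close>, hence
        all orbits, hence everything.\<close>
    let ?P = "{x \<in> carrier A. J +>\<^bsub>A\<^esub> x \<in> q.N.span ((\<lambda>x. J +>\<^bsub>A\<^esub> x) ` X)}"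
    have qX: "(\<lambda>x. J +>\<^bsub>A\<^esub> x) ` X \<subseteq> carrier (quot_algebra A J)" using X by auto
    interpret L: submodule R "q.N.span ((\<lambda>x. J +>\<^bsub>A\<^esub> x) ` X)" "quot_algebra A J"
      by (rule q.N.span_is_submodule[OF qX])
    have P: "submodule R ?P A" by (rule q.submodule_vimage) unfold_locales
    have XP: "X \<subseteq> ?P" using X q.N.in_own_span[OF qX] by auto
    have stable: "t \<otimes>\<^bsub>A\<^esub> x \<in> ?P" if "x \<in> ?P" for x
    proof -
      have x: "x \<in> carrier A" using that by simp
      have "u \<otimes>\<^bsub>A\<^esub> x \<in> J" unfolding J_def cgenideal_def using m_comm[OF u x] x by blast
      hence "J +>\<^bsub>A\<^esub> (u \<otimes>\<^bsub>A\<^esub> x) = \<zero>\<^bsub>quot_algebra A J\<^esub>"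
        by (simp add: J.a_rcos_const quot_algebra_sel FactRing_def)
      hence "J +>\<^bsub>A\<^esub> (t \<otimes>\<^bsub>A\<^esub> x) = c \<odot>\<^bsub>quot_algebra A J\<^esub> (J +>\<^bsub>A\<^esub> x)"
        using x u c by (simp add: tx)
      thus ?thesis using that tM c by simp
    qed
    have "orbits t X \<subseteq> ?P"
      by (rule orbits_minimal[OF tM _ XP stable]) blast
    hence "carrier A \<subseteq> ?P" using span_is_subset[OF _ P] full by blast
    thus "q.N.span ((\<lambda>x. J +>\<^bsub>A\<^esub> x) ` X) = carrier (quot_algebra A J)"
      using L.subset by (auto simp: carrier_quot_algebra)
  next
    assume "q.N.span ((\<lambda>x. J +>\<^bsub>A\<^esub> x) ` X) = carrier (quot_algebra A J)"
    hence sum: "\<exists>w\<in>span X. \<exists>b\<in>carrier A. a = w \<oplus>\<^bsub>A\<^esub> u \<otimes>\<^bsub>A\<^esub> b" if "a \<in> carrier A" for a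
      using image_coset_eq_carrier_iff[OF u spanX] that q.image_span[OF X] by (simp add: J_def)
    interpret W: submodule R "span (orbits t X)" A by (rule span_is_submodule[OF O])
    have XW: "span X \<subseteq> span (orbits t X)" by (rule span_is_monotone[OF subset_orbits[OF tM X]])
    have stable: "u \<otimes>\<^bsub>A\<^esub> w \<in> span (orbits t X)" if "w \<in> span (orbits t X)" for w
    proof -
      have w: "w \<in> carrier A" using that W.subset by blast
      have "t \<otimes>\<^bsub>A\<^esub> w \<in> span (orbits t X)"
        by (rule span_mult_stable[OF tM O subsetD[OF in_own_span[OF O] mult_orbits[OF tM X]] that])
      moreover have "u \<otimes>\<^bsub>A\<^esub> w = (\<ominus>\<^bsub>R\<^esub> c) \<odot>\<^bsub>A\<^esub> w \<oplus>\<^bsub>A\<^esub> t \<otimes>\<^bsub>A\<^esub> w"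
        using w u c by (simp add: tx smult_l_minus M.r_neg1)
      ultimately show ?thesis using that c by simp
    qed
    show "span (orbits t X) = carrier A"
      using sum XW by (intro nilpotent_nakayama[OF u nil W.submodule_axioms stable]) blast+
  qed
qed

text \<open>This is \<open>span_orbits_eq_carrier_iff\<close> at $c = 0$: the elements $u^k x$ with $k \ge n$ are zero,
  so finitely many powers of \<open>u\<close> already give all of \<open>A\<close>. It bounds the dimension of \<open>A\<close> by \<open>n\<close> times
  the number of generators of the quotient.\<close>

lemma span_nilpotent_powers:
  assumes u: "u \<in> carrier A" and nil: "u [^]\<^bsub>A\<^esub> (n::nat) = \<zero>\<^bsub>A\<^esub>" and X: "X \<subseteq> carrier A"
  defines "J \<equiv> PIdl\<^bsub>A\<^esub> u"
  assumes gen: "LinearCombinations.module.span R (quot_algebra A J) ((\<lambda>x. J +>\<^bsub>A\<^esub> x) ` X)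
      = carrier (quot_algebra A J)"
  shows "span ((\<lambda>(k, x). u [^]\<^bsub>A\<^esub> k \<otimes>\<^bsub>A\<^esub> x) ` ({..<n} \<times> X)) = carrier A"
proof -
  let ?S = "(\<lambda>(k, x). u [^]\<^bsub>A\<^esub> k \<otimes>\<^bsub>A\<^esub> x) ` ({..<n} \<times> X)"
  have S: "?S \<subseteq> carrier A"
    using m_closed[OF nat_pow_closed[OF u] subsetD[OF X]]
    by (intro image_subsetI) (simp only: split_def mem_Times_iff)
  interpret W: submodule R "span ?S" A by (rule span_is_submodule[OF S])
  have pow: "u [^]\<^bsub>A\<^esub> k \<otimes>\<^bsub>A\<^esub> x \<in> span ?S" if "x \<in> X" for x and k :: nat
  proof (cases "k < n")
    case True
    thus ?thesis
      using that by (intro subsetD[OF in_own_span[OF S]] image_eqI[of _ _ "(k, x)"]) simp_all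
  next
    case False
    hence "u [^]\<^bsub>A\<^esub> k = u [^]\<^bsub>A\<^esub> n \<otimes>\<^bsub>A\<^esub> u [^]\<^bsub>A\<^esub> (k - n)" using u by (simp add: nat_pow_mult)
    moreover have "x \<in> carrier A" using that X by blast
    ultimately have "u [^]\<^bsub>A\<^esub> k \<otimes>\<^bsub>A\<^esub> x = \<zero>\<^bsub>A\<^esub>" using u by (simp add: nil)
    thus ?thesis using W.zero_closed by simp
  qed
  have "orbits u X \<subseteq> span ?S" unfolding orbits_def using pow by blast
  moreover have "span (orbits u X) = carrier A"
    using span_orbits_eq_carrier_iff[OF u nil R.zero_closed _ X, of u] gen u unfolding J_def by simp
  ultimately show ?thesis using span_is_subset[OF _ W.submodule_axioms] W.subset by blast
qed

end

section \<open>The monomial basis of the truncated algebra\<close>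

lemma poly_algebra_xy_sel [simp]:
  "carrier poly_algebra_xy = UNIV" "add poly_algebra_xy = (+)" "mult poly_algebra_xy = (*)"
  "zero poly_algebra_xy = 0" "one poly_algebra_xy = 1"
  "smult poly_algebra_xy = (\<lambda>c p. [:[:c:]:] * p)"
  by (simp_all add: poly_algebra_xy_def)

lemma plain_algebra_xy: "plain_algebra class_ring poly_algebra_xy"
  by (rule plain_algebra.intro[OF algebra_poly_algebra_xy])

lemma finsum_poly_algebra_xy: "finsum poly_algebra_xy f S = sum f S"
proof -
  interpret P: plain_algebra class_ring poly_algebra_xy by (rule plain_algebra_xy)
  show ?thesis
    by (induction S rule: infinite_finite_induct) (auto simp: P.M.finsum_infinite P.M.finsum_insert)
qed

text \<open>The generators of the truncation ideal as monomials, so that multiplication by them is a shift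
  of coefficients.\<close>

lemma X_power: "[:[:0, 1:]:] ^ M = [:monom 1 M:]" for M :: nat
  by (simp add: poly_const_pow monom_altdef)

lemma Y_power: "[:0, 1:] ^ N = monom 1 N" for N :: nat
  by (simp add: monom_altdef)

lemma coeff_truncation_ideal:
  assumes "p \<in> truncation_ideal M N" "i < M" "j < N"
  shows "coeff (coeff p j) i = 0"
  using assms unfolding truncation_ideal_eq X_power Y_power
  by (auto simp: coeff_monom_mult)

lemma monom_in_truncation_ideal:
  assumes "M \<le> i \<or> N \<le> j"
  shows "monom (monom c i) j \<in> truncation_ideal M N"
proof (cases "M \<le> i")
  case True
  hence "monom (monom c i) j = [:monom 1 M:] * monom (monom c (i - M)) j + monom 1 N * 0"
    by (simp add: smult_monom mult_monom)
  thus ?thesis unfolding truncation_ideal_eq X_power Y_power by blast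
next
  case False
  hence "monom (monom c i) j = [:monom 1 M:] * 0 + monom 1 N * monom (monom c i) (j - N)"
    using assms by (simp add: mult_monom)
  thus ?thesis unfolding truncation_ideal_eq X_power Y_power by blast
qed

abbreviation residue :: "nat \<Rightarrow> nat \<Rightarrow> complex poly poly \<Rightarrow> complex poly poly set" where
  "residue M N p \<equiv> truncation_ideal M N +>\<^bsub>poly_algebra_xy\<^esub> p"

definition xy_monomials :: "nat \<Rightarrow> nat \<Rightarrow> complex poly poly set" where
  "xy_monomials M N = (\<lambda>(i, j). monom (monom 1 i) j) ` ({..<M} \<times> {..<N})"

lemma finite_xy_monomials: "finite (xy_monomials M N)"
  by (simp add: xy_monomials_def)

lemma inj_xy_monomial: "inj (\<lambda>(i, j). monom (monom (1 :: complex) i) j)"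
  by (auto simp: inj_def monom_eq_iff')

lemma card_xy_monomials: "card (xy_monomials M N) = M * N"
  unfolding xy_monomials_def
  by (subst card_image) (auto intro: inj_on_subset[OF inj_xy_monomial])

lemma mod_hom_residue:
  "mod_hom class_ring poly_algebra_xy (trunc_algebra M N) (residue M N)"
  unfolding trunc_algebra_def
  by (rule plain_algebra.mod_hom_coset[OF plain_algebra_xy ideal_truncation_ideal])

lemma carrier_trunc_algebra: "carrier (trunc_algebra M N) = range (residue M N)"
  unfolding trunc_algebra_def plain_algebra.carrier_quot_algebra[OF plain_algebra_xy] by simp

lemma residue_eq_zero_iff:
  "residue M N p = \<zero>\<^bsub>trunc_algebra M N\<^esub> \<longleftrightarrow> p \<in> truncation_ideal M N"
proof -
  interpret I: ideal "truncation_ideal M N" poly_algebra_xy by (rule ideal_truncation_ideal)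
  show ?thesis
    using I.a_rcos_const[of p] I.a_rcos_self[of p]
    by (auto simp: trunc_algebra_def quot_algebra_sel FactRing_def)
qed

text \<open>The polynomials whose residue lies in the span form a subspace. It contains every monomial,
  because a monomial outside the $M \times N$ box has residue zero.\<close>

lemma span_residue_monomials:
  "LinearCombinations.module.span class_ring (trunc_algebra M N) (residue M N ` xy_monomials M N)
     = carrier (trunc_algebra M N)"
proof -
  interpret r: mod_hom class_ring poly_algebra_xy "trunc_algebra M N" "residue M N"
    by (rule mod_hom_residue)
  let ?S = "residue M N ` xy_monomials M N"
  have S: "?S \<subseteq> carrier (trunc_algebra M N)" by (auto simp: carrier_trunc_algebra)
  interpret W: submodule class_ring "r.N.span ?S" "trunc_algebra M N"
    by (rule r.N.span_is_submodule[OF S])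
  interpret V: submodule class_ring "{p \<in> carrier poly_algebra_xy. residue M N p \<in> r.N.span ?S}" poly_algebra_xy
    by (rule r.submodule_vimage[OF W.submodule_axioms])
  let ?V = "{p. residue M N p \<in> r.N.span ?S}"
  have add: "p + q \<in> ?V" if "p \<in> ?V" "q \<in> ?V" for p q using V.m_closed[of p q] that by simp
  have smult: "[:[:c:]:] * p \<in> ?V" if "p \<in> ?V" for p c using V.smult_closed[of c p] that by simp
  have zero: "0 \<in> ?V" using V.zero_closed by simp
  have sum: "sum f I \<in> ?V" if "\<And>k. k \<in> I \<Longrightarrow> f k \<in> ?V" for f and I :: "nat set"
    using that
  proof (induction I rule: infinite_finite_induct)
    case (insert x F)
    have "f x + sum f F \<in> ?V" by (rule add) (use insert in auto)
    thus ?case using insert by simp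
  qed (use zero in auto)
  have monom1: "monom (monom 1 i) j \<in> ?V" for i j
  proof (cases "i < M \<and> j < N")
    case True
    hence "residue M N (monom (monom 1 i) j) \<in> ?S" by (auto simp: xy_monomials_def)
    thus ?thesis using r.N.in_own_span[OF S] by blast
  next
    case False
    hence "residue M N (monom (monom 1 i) j) = \<zero>\<^bsub>trunc_algebra M N\<^esub>"
      by (simp add: residue_eq_zero_iff monom_in_truncation_ideal not_less)
    thus ?thesis using W.zero_closed by simp
  qed
  have monom2: "monom (monom c i) j \<in> ?V" for c i j
    using smult[OF monom1[of i j], of c] by (simp add: smult_monom)
  have monom3: "monom q j \<in> ?V" for q j
  proof -
    have "monom q j = (\<Sum>i\<le>degree q. monom (monom (coeff q i) i) j)"
      by (simp only: monom_sum[symmetric] poly_as_sum_of_monoms)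
    moreover have "\<dots> \<in> ?V" by (rule sum) (rule monom2)
    ultimately show ?thesis by (simp only:)
  qed
  have "p \<in> ?V" for p
  proof -
    have "(\<Sum>j\<le>degree p. monom (coeff p j) j) \<in> ?V" by (rule sum) (rule monom3)
    thus ?thesis by (simp only: poly_as_sum_of_monoms)
  qed
  thus ?thesis using W.subset by (auto simp: carrier_trunc_algebra)
qed

text \<open>A linear relation between the residues lifts to a linear combination of monomials in the
  truncation ideal. Its coefficients are the coefficients of a polynomial inside the $M \times N$ box,
  where every element of the ideal has coefficient zero. Injectivity makes the number of residues
  equal to $MN$.\<close>

lemma residue_monomials_independent:
  "LinearCombinations.module.lin_indpt class_ring (trunc_algebra M N) (residue M N ` xy_monomials M N)"
  "inj_on (residue M N) (xy_monomials M N)"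
proof -
  interpret r: mod_hom class_ring poly_algebra_xy "trunc_algebra M N" "residue M N"
    by (rule mod_hom_residue)
  interpret I: ideal "truncation_ideal M N" poly_algebra_xy by (rule ideal_truncation_ideal)
  have coeff_comb: "coeff (coeff (\<Sum>m\<in>xy_monomials M N. [:[:g m:]:] * m) j) i = g (monom (monom 1 i) j)"
    if "i < M" "j < N" for g i j
  proof -
    have "(\<Sum>m\<in>xy_monomials M N. [:[:g m:]:] * m)
        = (\<Sum>(k, l)\<in>{..<M} \<times> {..<N}. monom (monom (g (monom (monom 1 k) l)) k) l)"
      unfolding xy_monomials_def
      by (subst sum.reindex) (auto intro!: sum.cong inj_on_subset[OF inj_xy_monomial] simp: smult_monom)
    hence "coeff (coeff (\<Sum>m\<in>xy_monomials M N. [:[:g m:]:] * m) j) i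
        = (\<Sum>kl\<in>{..<M} \<times> {..<N}. if kl = (i, j) then g (monom (monom 1 i) j) else 0)"
      by (simp only: coeff_sum, intro sum.cong refl) (auto split: if_splits)
    also have "\<dots> = g (monom (monom 1 i) j)" using that by simp
    finally show ?thesis .
  qed
  show inj: "inj_on (residue M N) (xy_monomials M N)"
  proof (rule inj_onI)
    fix p q assume p: "p \<in> xy_monomials M N" and q: "q \<in> xy_monomials M N"
      and eq: "residue M N p = residue M N q"
    have "p \<in> residue M N q" using I.a_rcos_self[of p] eq by simp
    hence mem: "p - q \<in> truncation_ideal M N" by (auto simp: a_r_coset_def')
    from p obtain i j where ij: "i < M" "j < N" "p = monom (monom 1 i) j" by (auto simp: xy_monomials_def)
    from q obtain k l where kl: "q = monom (monom 1 k) l" by (auto simp: xy_monomials_def)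
    show "p = q" using coeff_truncation_ideal[OF mem ij(1,2)] by (auto simp: ij kl split: if_splits)
  qed
  show "r.N.lin_indpt (residue M N ` xy_monomials M N)"
  proof (rule r.N.finite_lin_indpt2)
    show "finite (residue M N ` xy_monomials M N)" by (simp add: finite_xy_monomials)
    show "residue M N ` xy_monomials M N \<subseteq> carrier (trunc_algebra M N)" by (auto simp: carrier_trunc_algebra)
    fix a assume a: "r.N.lincomb a (residue M N ` xy_monomials M N) = \<zero>\<^bsub>trunc_algebra M N\<^esub>"
    let ?g = "\<lambda>m. a (residue M N m)"
    have "r.N.lincomb a (residue M N ` xy_monomials M N)
        = finsum (trunc_algebra M N) (\<lambda>m. ?g m \<odot>\<^bsub>trunc_algebra M N\<^esub> residue M N m) (xy_monomials M N)"
      unfolding r.N.lincomb_def by (rule r.N.M.finsum_reindex) (auto simp: inj)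
    also have "\<dots> = finsum (trunc_algebra M N)
        (\<lambda>m. residue M N (?g m \<odot>\<^bsub>poly_algebra_xy\<^esub> m)) (xy_monomials M N)"
      by (intro r.N.M.finsum_cong') (auto simp del: poly_algebra_xy_sel(6))
    also have "\<dots> = residue M N (finsum poly_algebra_xy (\<lambda>m. ?g m \<odot>\<^bsub>poly_algebra_xy\<^esub> m) (xy_monomials M N))"
      by (rule r.hom_sum[symmetric]) auto
    finally have "(\<Sum>m\<in>xy_monomials M N. [:[:?g m:]:] * m) \<in> truncation_ideal M N"
      using a by (simp add: finsum_poly_algebra_xy flip: residue_eq_zero_iff)
    hence "?g (monom (monom 1 i) j) = 0" if "i < M" "j < N" for i j
      using coeff_comb[OF that, of ?g] coeff_truncation_ideal[OF _ that] by simp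
    thus "\<forall>v\<in>residue M N ` xy_monomials M N. a v = \<zero>\<^bsub>class_ring\<^esub>"
      by (auto simp: xy_monomials_def)
  qed
qed

section \<open>The minimal number of probes\<close>

lemma plain_algebra_trunc: "plain_algebra class_ring (trunc_algebra M N)"
  by (rule plain_algebra.intro[OF algebra_trunc_algebra])

lemma vectorspace_cokernel:
  "U \<in> carrier (trunc_algebra M N) \<Longrightarrow> vectorspace class_ring (cokernel_algebra M N U)"
  by (rule vectorspace_algebra[OF algebra_cokernel_algebra])

lemma mod_hom_cokernel:
  assumes "U \<in> carrier (trunc_algebra M N)"
  shows "mod_hom class_ring (trunc_algebra M N) (cokernel_algebra M N U)
    (\<lambda>x. (PIdl\<^bsub>trunc_algebra M N\<^esub> U) +>\<^bsub>trunc_algebra M N\<^esub> x)"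
proof -
  interpret A: plain_algebra class_ring "trunc_algebra M N" by (rule plain_algebra_trunc)
  show ?thesis
    unfolding cokernel_algebra_def by (rule A.mod_hom_coset[OF A.cgenideal_ideal[OF assms]])
qed

lemma carrier_cokernel_algebra:
  "carrier (cokernel_algebra M N U) =
     (\<lambda>x. (PIdl\<^bsub>trunc_algebra M N\<^esub> U) +>\<^bsub>trunc_algebra M N\<^esub> x) ` carrier (trunc_algebra M N)"
  unfolding cokernel_algebra_def by (rule plain_algebra.carrier_quot_algebra[OF plain_algebra_trunc])

lemma orbits_span_iff_classes_span:
  assumes U: "U \<in> carrier (trunc_algebra M N)"
    and nil: "U [^]\<^bsub>trunc_algebra M N\<^esub> (n::nat) = \<zero>\<^bsub>trunc_algebra M N\<^esub>"
    and T: "T = (c \<odot>\<^bsub>trunc_algebra M N\<^esub> \<one>\<^bsub>trunc_algebra M N\<^esub>) \<oplus>\<^bsub>trunc_algebra M N\<^esub> U"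
    and B: "B \<in> {1..r} \<rightarrow> carrier (trunc_algebra M N)"
  shows "orbits_span M N T r B \<longleftrightarrow> classes_span M N U r B"
proof -
  interpret A: plain_algebra class_ring "trunc_algebra M N" by (rule plain_algebra_trunc)
  have "{(T [^]\<^bsub>trunc_algebra M N\<^esub> n) \<otimes>\<^bsub>trunc_algebra M N\<^esub> B j | (n::nat) j. j \<in> {1..r}}
      = A.orbits T (B ` {1..r})"
    unfolding A.orbits_def by blast
  moreover have "B ` {1..r} \<subseteq> carrier (trunc_algebra M N)" using B by blast
  ultimately show ?thesis
    using A.span_orbits_eq_carrier_iff[OF U nil _ T, of "B ` {1..r}"]
    unfolding orbits_span_def classes_span_def cokernel_algebra_def image_image by simp
qed

lemma mu_le_if_classes_span:
  assumes U: "U \<in> carrier (trunc_algebra M N)"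
    and B: "B \<in> {1..r} \<rightarrow> carrier (trunc_algebra M N)" and "classes_span M N U r B"
  shows "mu M N U \<le> r"
proof -
  interpret Q: vectorspace class_ring "cokernel_algebra M N U" by (rule vectorspace_cokernel[OF U])
  let ?q = "\<lambda>x. (PIdl\<^bsub>trunc_algebra M N\<^esub> U) +>\<^bsub>trunc_algebra M N\<^esub> x"
  have "mu M N U \<le> card ((\<lambda>j. ?q (B j)) ` {1..r})"
    unfolding mu_def
  proof (rule Q.gen_ge_dim)
    show "(\<lambda>j. ?q (B j)) ` {1..r} \<subseteq> carrier (cokernel_algebra M N U)"
      unfolding carrier_cokernel_algebra using B by blast
    show "Q.gen_set ((\<lambda>j. ?q (B j)) ` {1..r})" using assms(3) by (simp only: classes_span_def)
  qed simp
  also have "\<dots> \<le> r" using card_image_le[of "{1..r}" "\<lambda>j. ?q (B j)"] by simp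
  finally show ?thesis .
qed

text \<open>The images of the finitely many monomials generate the cokernel, so the minimum that defines
  \<^const>\<open>mu\<close> is attained by some generating set; choosing preimages of its elements gives the family.\<close>

lemma classes_span_mu:
  assumes U: "U \<in> carrier (trunc_algebra M N)"
  shows "\<exists>B \<in> {1..mu M N U} \<rightarrow> carrier (trunc_algebra M N). classes_span M N U (mu M N U) B"
proof -
  interpret q: mod_hom class_ring "trunc_algebra M N" "cokernel_algebra M N U"
    "\<lambda>x. (PIdl\<^bsub>trunc_algebra M N\<^esub> U) +>\<^bsub>trunc_algebra M N\<^esub> x"
    by (rule mod_hom_cokernel[OF U])
  interpret Q: vectorspace class_ring "cokernel_algebra M N U" by (rule vectorspace_cokernel[OF U])
  let ?q = "\<lambda>x. (PIdl\<^bsub>trunc_algebra M N\<^esub> U) +>\<^bsub>trunc_algebra M N\<^esub> x"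
  let ?S = "residue M N ` xy_monomials M N"
  have S: "?S \<subseteq> carrier (trunc_algebra M N)" by (auto simp: carrier_trunc_algebra)
  have "q.N.gen_set (?q ` ?S)"
    using q.image_span[OF S] by (simp only: span_residue_monomials carrier_cokernel_algebra)
  moreover have "?q ` ?S \<subseteq> carrier (cokernel_algebra M N U)"
    unfolding carrier_cokernel_algebra using S by (rule image_mono)
  moreover have "finite (?q ` ?S)" by (simp add: finite_xy_monomials)
  ultimately have "\<exists>n G. finite G \<and> card G = n \<and> G \<subseteq> carrier (cokernel_algebra M N U) \<and> q.N.gen_set G"
    by blast
  hence "\<exists>G. finite G \<and> card G = mu M N U \<and> G \<subseteq> carrier (cokernel_algebra M N U) \<and> q.N.gen_set G"
    unfolding mu_def Q.dim_def by (rule LeastI_ex)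
  then obtain G where G: "finite G" "card G = mu M N U"
      "G \<subseteq> carrier (cokernel_algebra M N U)" "q.N.gen_set G"
    by blast
  obtain h where h: "bij_betw h {1..mu M N U} G"
    using ex_bij_betw_nat_finite_1[OF G(1)] G(2) by auto
  have "\<exists>x. x \<in> carrier (trunc_algebra M N) \<and> h j = ?q x" if "j \<in> {1..mu M N U}" for j
  proof -
    have "h j \<in> ?q ` carrier (trunc_algebra M N)"
      unfolding carrier_cokernel_algebra[symmetric] by (rule subsetD[OF G(3) bij_betwE[OF h, rule_format, OF that]])
    thus ?thesis by (simp only: image_iff Bex_def)
  qed
  hence "\<exists>B. \<forall>j\<in>{1..mu M N U}. B j \<in> carrier (trunc_algebra M N) \<and> h j = ?q (B j)"
    by (intro bchoice ballI)
  then obtain B where B: "\<And>j. j \<in> {1..mu M N U} \<Longrightarrow> B j \<in> carrier (trunc_algebra M N)"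
      "\<And>j. j \<in> {1..mu M N U} \<Longrightarrow> h j = ?q (B j)"
    by blast
  have "(\<lambda>j. ?q (B j)) ` {1..mu M N U} = h ` {1..mu M N U}"
    by (rule image_cong[OF refl B(2)[symmetric]])
  hence "(\<lambda>j. ?q (B j)) ` {1..mu M N U} = G"
    by (simp only: bij_betw_imp_surj_on[OF h])
  hence "classes_span M N U (mu M N U) B" unfolding classes_span_def using G(4) by (simp only:)
  thus ?thesis using B(1) by blast
qed

text \<open>The independent set of $MN$ monomials is no larger than the spanning set of at most $nr$ elements
  from \<open>span_nilpotent_powers\<close>.\<close>

lemma trunc_dim_le_if_classes_span:
  assumes U: "U \<in> carrier (trunc_algebra M N)"
    and nil: "U [^]\<^bsub>trunc_algebra M N\<^esub> (n::nat) = \<zero>\<^bsub>trunc_algebra M N\<^esub>"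
    and B: "B \<in> {1..r} \<rightarrow> carrier (trunc_algebra M N)" and cl: "classes_span M N U r B"
  shows "M * N \<le> n * r"
proof -
  interpret A: plain_algebra class_ring "trunc_algebra M N" by (rule plain_algebra_trunc)
  interpret V: vectorspace class_ring "trunc_algebra M N"
    by (rule vectorspace_algebra[OF algebra_trunc_algebra])
  let ?X = "B ` {1..r}"
  let ?f = "\<lambda>(k::nat, x). U [^]\<^bsub>trunc_algebra M N\<^esub> k \<otimes>\<^bsub>trunc_algebra M N\<^esub> x"
  have X: "?X \<subseteq> carrier (trunc_algebra M N)" using B by blast
  have gen: "A.span (?f ` ({..<n} \<times> ?X)) = carrier (trunc_algebra M N)"
    using cl unfolding classes_span_def cokernel_algebra_def
    by (intro A.span_nilpotent_powers[OF U nil X]) (simp only: image_image)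
  have sub: "?f ` ({..<n} \<times> ?X) \<subseteq> carrier (trunc_algebra M N)"
    using A.m_closed[OF A.nat_pow_closed[OF U] subsetD[OF X]]
    by (intro image_subsetI) (simp only: split_def mem_Times_iff)
  have "M * N = card (residue M N ` xy_monomials M N)"
    by (simp add: card_image[OF residue_monomials_independent(2)] card_xy_monomials)
  also have "\<dots> \<le> card (?f ` ({..<n} \<times> ?X))"
    by (rule V.li_smaller_than_gen[OF _ _ _ sub residue_monomials_independent(1) gen])
       (auto simp: finite_xy_monomials carrier_trunc_algebra)
  also have "\<dots> \<le> card ({..<n} \<times> ?X)" by (rule card_image_le) simp
  also have "\<dots> \<le> n * r" using card_image_le[of "{1..r}" B] by (simp add: card_cartesian_product)
  finally show ?thesis .
qed

text \<open>The exponent $M + N$ witnesses that the minimum is taken over a nonempty set.\<close>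

lemma nilpotency_index:
  assumes "0 < M" "0 < N" "U \<in> carrier (trunc_algebra M N)" "const_coeff U = 0"
  shows "0 < nilpotency_index M N U"
    and "U [^]\<^bsub>trunc_algebra M N\<^esub> nilpotency_index M N U = \<zero>\<^bsub>trunc_algebra M N\<^esub>"
proof -
  have "0 < M + N \<and> U [^]\<^bsub>trunc_algebra M N\<^esub> (M + N) = \<zero>\<^bsub>trunc_algebra M N\<^esub>"
    using assms by (simp add: const_coeff_zero_nilpotent)
  from LeastI[of "\<lambda>n. 0 < n \<and> U [^]\<^bsub>trunc_algebra M N\<^esub> n = \<zero>\<^bsub>trunc_algebra M N\<^esub>", OF this]
  show "0 < nilpotency_index M N U"
    and "U [^]\<^bsub>trunc_algebra M N\<^esub> nilpotency_index M N U = \<zero>\<^bsub>trunc_algebra M N\<^esub>"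
    unfolding nilpotency_index_def by auto
qed

theorem proposition3p1:
  fixes M N :: nat and c :: complex and T U :: "complex poly poly set"
  assumes "0 < M" and "0 < N"
    and "U \<in> carrier (trunc_algebra M N)" and "const_coeff U = 0"
    and "T = (c \<odot>\<^bsub>trunc_algebra M N\<^esub> \<one>\<^bsub>trunc_algebra M N\<^esub>) \<oplus>\<^bsub>trunc_algebra M N\<^esub> U"
  shows "(\<forall>r B. B \<in> {1..r} \<rightarrow> carrier (trunc_algebra M N) \<longrightarrow>
            (orbits_span M N T r B \<longleftrightarrow> classes_span M N U r B))
       \<and> (\<exists>B \<in> {1..mu M N U} \<rightarrow> carrier (trunc_algebra M N). orbits_span M N T (mu M N U) B)
       \<and> (\<forall>r. \<forall>B \<in> {1..r} \<rightarrow> carrier (trunc_algebra M N). orbits_span M N T r B \<longrightarrow> mu M N U \<le> r)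
       \<and> int (mu M N U) \<ge> \<lceil>real (M * N) / real (nilpotency_index M N U)\<rceil>"
proof (intro conjI allI impI ballI)
  let ?\<nu> = "nilpotency_index M N U"
  note nil = nilpotency_index[OF assms(1-4)]
  note iff = orbits_span_iff_classes_span[OF assms(3) nil(2) assms(5)]
  obtain B where B: "B \<in> {1..mu M N U} \<rightarrow> carrier (trunc_algebra M N)"
      "classes_span M N U (mu M N U) B"
    using classes_span_mu[OF assms(3)] by blast
  show "orbits_span M N T r B \<longleftrightarrow> classes_span M N U r B"
    if "B \<in> {1..r} \<rightarrow> carrier (trunc_algebra M N)" for r B
    by (rule iff[OF that])
  show "\<exists>B \<in> {1..mu M N U} \<rightarrow> carrier (trunc_algebra M N). orbits_span M N T (mu M N U) B"
    using B iff[OF B(1)] by blast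
  show "mu M N U \<le> r"
    if "B \<in> {1..r} \<rightarrow> carrier (trunc_algebra M N)" "orbits_span M N T r B" for r B
    using mu_le_if_classes_span[OF assms(3) that(1)] iff[OF that(1)] that(2) by blast
  have "M * N \<le> ?\<nu> * mu M N U"
    by (rule trunc_dim_le_if_classes_span[OF assms(3) nil(2) B])
  hence "real (M * N) \<le> real (mu M N U) * real ?\<nu>"
    by (simp only: of_nat_mult[symmetric] of_nat_le_iff mult.commute)
  hence "real (M * N) / real ?\<nu> \<le> real (mu M N U)"
    using nil(1) by (simp only: pos_divide_le_eq of_nat_0_less_iff)
  thus "int (mu M N U) \<ge> \<lceil>real (M * N) / real ?\<nu>\<rceil>"
    by (simp only: ceiling_le_iff of_int_of_nat_eq)
qed

end
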